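(* Let $p$ be prime and let $d>2$ be an integer divisible by $p$. If every subset of $\mathcal E_d^{(p)}$ which is a set of Bohr recurrence in $\mathbb F_p^\omega$ is also a set of chromatic recurrence in $\mathbb F_p^\omega$, then every subset of $\mathbb F_p^\omega$ which is a set of Bohr recurrence is a set of chromatic recurrence.
   Context: $\mathbb F_p$ is the additive group $\mathbb Z/p\mathbb Z$, and $\mathbb F_p^\omega$ is the (discrete) direct sum of countably many copies of $\mathbb F_p$, with standard basis $\mathbf e_1=(1,0,0,\dots)$, $\mathbf e_2=(0,1,0,\dots)$, etc. For a finite $F\subseteq\mathbb N$, $\mathbf e_F:=\sum_{n\in F}\mathbf e_n$, and $\mathcal E_d^{(p)}:=\{\mathbf e_F:F\subseteq\mathbb N,\ |F|=d\}\subseteq \mathbb F_p^\omega$. $\mathbb T=\mathbb R/\mathbb Z$; for $\mathbf x=(x_1,\dots,x_k)\in\mathbb T^k$, $\|\mathbf x\|:=\max_{j\le k}\min_{n\in\mathbb Z}|x_j-n|$. For a discrete abelian group $G$: $S\subseteq G$ is a set of Bohr recurrence if for every $k\in\mathbb N$, every homomorphism $\rho:G\to\mathbb T^k$, and every $\varepsilon>0$, there exists $s\in S$ with $\|\rho(s)\|<\varepsilon$. $S\subseteq G$ is a set of chromatic recurrence if for every $r\in\mathbb N$ and every $f:G\to\{1,\dots,r\}$ there exist $a,b\in G$ such that $f(a)=f(b)$ and $b-a\in S$. *)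

theory Defs
  imports
    Complex_Main
    "HOL-Library.Poly_Mapping"
    "Berlekamp_Zassenhaus.Finite_Field"
begin

section \<open>The circle group\<close>

quotient_type circle = real / "\<lambda>x y :: real. x - y \<in> \<int>"
proof (rule equivpI)
  show "reflp (\<lambda>x y :: real. x - y \<in> \<int>)"
    by (rule reflpI) simp
  show "symp (\<lambda>x y :: real. x - y \<in> \<int>)"
    by (rule sympI) (metis Ints_minus minus_diff_eq)
  show "transp (\<lambda>x y :: real. x - y \<in> \<int>)"
    by (rule transpI) (metis Ints_add diff_add_cancel add_diff_eq)
qed

instantiation circle :: ab_group_add
begin

lift_definition zero_circle :: circle is 0 .

lift_definition plus_circle :: "circle \<Rightarrow> circle \<Rightarrow> circle" is "(+)"
  by (metis Ints_add add_diff_add)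

lift_definition uminus_circle :: "circle \<Rightarrow> circle" is uminus
  by (metis Ints_minus minus_diff_minus)

lift_definition minus_circle :: "circle \<Rightarrow> circle \<Rightarrow> circle" is "(-)"
proof -
  fix x x' y y' :: real
  assume "x - x' \<in> \<int>" "y - y' \<in> \<int>"
  then have "(x - x') - (y - y') \<in> \<int>" by (rule Ints_diff)
  then show "(x - y) - (x' - y') \<in> \<int>" by (simp add: algebra_simps)
qed

instance
  by standard (transfer, simp add: algebra_simps)+

end

text \<open>The infimum below is a minimum, see \<open>circle_norm_attained\<close>.\<close>

lift_definition circle_norm :: "circle \<Rightarrow> real"
  is "\<lambda>x. INF n::int. \<bar>x - of_int n\<bar>"
proof -
  fix x y :: real
  assume "x - y \<in> \<int>"
  then obtain m :: int where m: "x = y + of_int m"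
    by (metis Ints_cases add.commute diff_add_cancel)
  have "range (\<lambda>n::int. \<bar>x - of_int n\<bar>) = range (\<lambda>n::int. \<bar>y - of_int n\<bar>)"
  proof (intro equalityI subsetI; elim rangeE)
    fix z and n :: int
    assume "z = \<bar>x - of_int n\<bar>"
    then have "z = \<bar>y - of_int (n - m)\<bar>" by (simp add: m)
    then show "z \<in> range (\<lambda>n::int. \<bar>y - of_int n\<bar>)" by blast
  next
    fix z and n :: int
    assume "z = \<bar>y - of_int n\<bar>"
    then have "z = \<bar>x - of_int (n + m)\<bar>" by (simp add: m)
    then show "z \<in> range (\<lambda>n::int. \<bar>x - of_int n\<bar>)" by blast
  qed
  then show "(INF n::int. \<bar>x - of_int n\<bar>) = (INF n::int. \<bar>y - of_int n\<bar>)" by simp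
qed

lemma circle_norm_attained:
  "circle_norm (abs_circle x) = \<bar>x - of_int (round x)\<bar>"
  "\<bar>x - of_int (round x)\<bar> \<le> \<bar>x - of_int n\<bar>"
proof -
  have min: "\<bar>x - of_int (round x)\<bar> \<le> \<bar>x - of_int n\<bar>" for n
    using round_diff_minimal[of x n] by simp
  then show "\<bar>x - of_int (round x)\<bar> \<le> \<bar>x - of_int n\<bar>" .
  have "(INF n::int. \<bar>x - of_int n\<bar>) = \<bar>x - of_int (round x)\<bar>"
    by (rule cInf_eq_minimum) (use min in auto)
  then show "circle_norm (abs_circle x) = \<bar>x - of_int (round x)\<bar>"
    by (simp add: circle_norm.abs_eq)
qed

text \<open>
  A point of the \<open>k\<close>-dimensional torus, \<open>k \<ge> 1\<close>, is given by its coordinates with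
  indices \<open>1, \<dots>, k\<close>; the values of the function at other indices are irrelevant.
\<close>

definition torus_norm :: "nat \<Rightarrow> (nat \<Rightarrow> circle) \<Rightarrow> real" where
  "torus_norm k x = (MAX j\<in>{1..k}. circle_norm (x j))"

definition torus_hom :: "nat \<Rightarrow> ('g::ab_group_add \<Rightarrow> nat \<Rightarrow> circle) \<Rightarrow> bool" where
  "torus_hom k \<rho> \<longleftrightarrow> (\<forall>j\<in>{1..k}. additive (\<lambda>g. \<rho> g j))"

section \<open>Sets of recurrence in a discrete abelian group\<close>

definition Bohr_recurrence :: "'g::ab_group_add set \<Rightarrow> bool" where
  "Bohr_recurrence S \<longleftrightarrow>
    (\<forall>k\<ge>1. \<forall>\<rho>. torus_hom k \<rho> \<longrightarrow> (\<forall>\<epsilon>>0. \<exists>s\<in>S. torus_norm k (\<rho> s) < \<epsilon>))"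

definition chromatic_recurrence :: "'g::ab_group_add set \<Rightarrow> bool" where
  "chromatic_recurrence S \<longleftrightarrow>
    (\<forall>r::nat. \<forall>f :: 'g \<Rightarrow> nat. range f \<subseteq> {1..r} \<longrightarrow> (\<exists>a b. f a = f b \<and> b - a \<in> S))"

section \<open>The direct sum of countably many copies of \<open>\<int>/p\<int>\<close>\<close>

text \<open>
  The prime \<open>p\<close> is the cardinality of the type \<open>'p\<close>, and \<open>'p mod_ring\<close> is \<open>\<int>/p\<int>\<close>.
  Coordinates are indexed by the type \<open>nat\<close>, that is, starting from 0.
\<close>

type_synonym 'p Fp_omega = "nat \<Rightarrow>\<^sub>0 'p mod_ring"

definition basis_sum :: "nat set \<Rightarrow> 'p::prime_card Fp_omega" where
  "basis_sum F = (\<Sum>n\<in>F. Poly_Mapping.single n 1)"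

definition basis_sums :: "nat \<Rightarrow> 'p::prime_card Fp_omega set" where
  "basis_sums d = {basis_sum F | F. finite F \<and> card F = d}"

end

(* Let S be a set of Bohr recurrence in G = F_p^omega, and let phi : G -> G be an endomorphism under
   which every element of G is the image of infinitely many basis vectors e_n. If
   S' = {b in E_d | phi b in S} is a set of chromatic recurrence, then so is phi(S') and hence S;
   thus it suffices that S' is a set of Bohr recurrence. A homomorphism rho from G to a torus takes
   only finitely many values on the e_n; assign to every x in G a colour kappa x attained by rho
   infinitely often on the e_n with phi e_n = x. If s in S is a sum of d elements of the same colour
   c, lift these to distinct basis vectors of rho-value c: this gives e_F in S' with
   rho e_F = d c = 0, as p divides d.

   Such an s exists by a Bogolyubov-type theorem: among finitely many colours, some class A on F_p^n
   satisfies A + ... + A (d summands, p | d, d >= 3) \<supseteq> W for a subspace W whose codimension is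
   bounded independently of n. Indeed, a coset x + W maximizing the density of A minus a multiple of
   the codimension has A' = A \<inter> (x + W) Fourier-uniform relative to W, and then A' + A' + A' = 3 x + W.
   By compactness, S meets every subspace W of bounded codimension in F_p^n once n is large. *)
theory Submission
  imports Defs "HOL-Library.Countable_Set"
begin

section \<open>Fourier analysis and dense cosets\<close>

definition mod_ring_char :: "'p::prime_card mod_ring \<Rightarrow> complex" where
  "mod_ring_char a = cis (2 * pi * (of_int (to_int_mod_ring a) / of_nat CARD('p)))"

lemma to_int_mod_ring_bounds:
  "0 \<le> to_int_mod_ring (a :: 'p::prime_card mod_ring)" "to_int_mod_ring a < int CARD('p)"
  by (transfer, simp)+

lemma mod_ring_char_0 [simp]: "mod_ring_char 0 = 1"
  by (simp add: mod_ring_char_def)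

lemma mod_ring_char_add: "mod_ring_char (a + b) = mod_ring_char a * mod_ring_char b"
  for a b :: "'p::prime_card mod_ring"
proof -
  let ?p = "real CARD('p)" and ?m = "to_int_mod_ring a + to_int_mod_ring b"
  have "?m = int CARD('p) * (?m div int CARD('p)) + to_int_mod_ring (a + b)"
    by (simp add: to_int_mod_ring_add)
  then have "real_of_int ?m = ?p * of_int (?m div int CARD('p)) + of_int (to_int_mod_ring (a + b))"
    by (metis of_int_add of_int_mult of_int_of_nat_eq)
  then have "of_int ?m / ?p = of_int (?m div int CARD('p)) + of_int (to_int_mod_ring (a + b)) / ?p"
    by (simp add: field_simps)
  then have "2 * pi * (of_int (to_int_mod_ring a) / ?p) + 2 * pi * (of_int (to_int_mod_ring b) / ?p)
    = 2 * pi * of_int (?m div int CARD('p)) + 2 * pi * (of_int (to_int_mod_ring (a + b)) / ?p)"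
    by (metis (no_types, lifting) add_divide_distrib distrib_left of_int_add)
  then show ?thesis
    unfolding mod_ring_char_def cis_mult by (simp add: cis_mult[symmetric] cis_multiple_2pi)
qed

lemma norm_mod_ring_char [simp]: "norm (mod_ring_char a) = 1"
  by (simp add: mod_ring_char_def)

lemma cnj_mod_ring_char: "cnj (mod_ring_char a) = mod_ring_char (- a)"
proof -
  have "mod_ring_char a * mod_ring_char (- a) = 1"
    by (simp flip: mod_ring_char_add)
  moreover have "mod_ring_char a * cnj (mod_ring_char a) = 1"
    by (simp add: complex_norm_square[symmetric])
  ultimately show ?thesis
    by (metis mult_cancel_left mult_zero_left zero_neq_one)
qed

lemma mod_ring_char_eq_1_iff: "mod_ring_char a = 1 \<longleftrightarrow> a = 0"
  for a :: "'p::prime_card mod_ring"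
proof
  let ?p = "real CARD('p)"
  have p: "?p > 0" by simp
  assume "mod_ring_char a = 1"
  then have "cos (2 * pi * (of_int (to_int_mod_ring a) / ?p)) = 1"
    by (metis mod_ring_char_def cis.simps(1) one_complex.simps(1))
  then obtain n :: int where "2 * pi * (of_int (to_int_mod_ring a) / ?p) = of_int n * 2 * pi"
    by (auto simp: cos_one_2pi_int)
  then have "2 * pi * (of_int (to_int_mod_ring a) / ?p) = 2 * pi * of_int n"
    by (simp only: mult_ac)
  then have "of_int (to_int_mod_ring a) / ?p = of_int n"
    by (simp only: mult_cancel_left) simp
  then have "real_of_int (to_int_mod_ring a) = real_of_int (n * int CARD('p))"
    using p by (simp add: field_simps)
  then have "to_int_mod_ring a = n * int CARD('p)"
    by linarith
  then have "to_int_mod_ring a mod int CARD('p) = 0" by simp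
  then have "to_int_mod_ring a = 0"
    using to_int_mod_ring_bounds[of a] by simp
  then show "a = 0" by simp
qed simp

text \<open>Shifting the summation index by 1 multiplies the sum by \<open>mod_ring_char 1\<close>,
  which is not 1.\<close>

lemma sum_mod_ring_char: "(\<Sum>c\<in>UNIV. mod_ring_char (c :: 'p::prime_card mod_ring)) = 0"
proof -
  let ?s = "\<Sum>c\<in>UNIV. mod_ring_char (c :: 'p mod_ring)"
  have "?s = (\<Sum>c\<in>UNIV. mod_ring_char (c + 1 :: 'p mod_ring))"
    by (rule sum.reindex_bij_witness[of _ "\<lambda>c. c + 1" "\<lambda>c. c - 1"]) auto
  also have "\<dots> = ?s * mod_ring_char (1 :: 'p mod_ring)"
    by (simp add: mod_ring_char_add sum_distrib_right)
  finally have "?s * (1 - mod_ring_char (1 :: 'p mod_ring)) = 0"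
    by (simp add: algebra_simps)
  then show ?thesis
    using mod_ring_char_eq_1_iff[of "1 :: 'p mod_ring"] by auto
qed

section \<open>Orthogonality and duality for a finite group with a nondegenerate pairing\<close>

locale finite_pairing =
  fixes G :: "'a::ab_group_add set" and B :: "'a \<Rightarrow> 'a \<Rightarrow> 'p::prime_card mod_ring"
  assumes finite_G: "finite G" and zero_G: "0 \<in> G"
    and diff_G: "\<And>x y. x \<in> G \<Longrightarrow> y \<in> G \<Longrightarrow> x - y \<in> G"
    and B_add: "\<And>x y z. B x (y + z) = B x y + B x z"
    and B_sym: "\<And>x y. B x y = B y x"
    and B_nondeg: "\<And>x. x \<in> G \<Longrightarrow> x \<noteq> 0 \<Longrightarrow> \<exists>y\<in>G. B x y \<noteq> 0"
begin

definition subgp :: "'a set \<Rightarrow> bool" where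
  "subgp W \<longleftrightarrow> W \<subseteq> G \<and> 0 \<in> W \<and> (\<forall>x\<in>W. \<forall>y\<in>W. x - y \<in> W)"

text \<open>The pairing identifies \<open>G\<close> with its own dual, so frequencies are elements
  of \<open>G\<close> and the annihilator of \<open>W\<close> lies inside \<open>G\<close>.\<close>

definition perp :: "'a set \<Rightarrow> 'a set" where
  "perp W = {v \<in> G. \<forall>w\<in>W. B v w = 0}"

lemma subgp_G: "subgp G"
  using zero_G diff_G by (auto simp: subgp_def)

lemma subgp_uminus: "subgp W \<Longrightarrow> x \<in> W \<Longrightarrow> - x \<in> W"
  unfolding subgp_def by (metis diff_0)

lemma subgp_add: "subgp W \<Longrightarrow> x \<in> W \<Longrightarrow> y \<in> W \<Longrightarrow> x + y \<in> W"
  using subgp_uminus[of W y] unfolding subgp_def by (metis diff_minus_eq_add)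

lemma subgp_diff: "subgp W \<Longrightarrow> x \<in> W \<Longrightarrow> y \<in> W \<Longrightarrow> x - y \<in> W"
  unfolding subgp_def by blast

lemma subgp_finite: "subgp W \<Longrightarrow> finite W"
  unfolding subgp_def using finite_G finite_subset by blast

lemma subgp_card_pos: "subgp W \<Longrightarrow> card W > 0"
  using subgp_finite[of W] by (auto simp: card_gt_0_iff subgp_def)

lemma additive_B: "additive (B v)"
  by unfold_locales (rule B_add)

lemmas B_zero [simp] = additive.zero[OF additive_B]
lemmas B_minus = additive.minus[OF additive_B]
lemmas B_diff = additive.diff[OF additive_B]

lemma B_zero_left [simp]: "B 0 v = 0"
  using B_sym[of 0 v] by simp

lemma subgp_perp: "subgp W \<Longrightarrow> subgp (perp W)"
  using diff_G zero_G unfolding subgp_def perp_def by (auto simp: B_sym[of _ w for w] B_diff)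

lemma subgp_kernel: "subgp W \<Longrightarrow> subgp {w \<in> W. B v w = 0}"
  unfolding subgp_def by (auto simp: B_diff)

text \<open>Translating by an element of \<open>W\<close> on which \<open>B v\<close> is nonzero
  multiplies the sum by a factor other than 1.\<close>

lemma char_sum:
  assumes "subgp W"
  shows "(\<Sum>w\<in>W. mod_ring_char (B v w)) = (if \<forall>w\<in>W. B v w = 0 then of_nat (card W) else 0)"
proof (cases "\<forall>w\<in>W. B v w = 0")
  case False
  then obtain u where u: "u \<in> W" "B v u \<noteq> 0" by blast
  let ?s = "\<Sum>w\<in>W. mod_ring_char (B v w)"
  have "?s = (\<Sum>w\<in>W. mod_ring_char (B v (w + u)))"
    by (rule sum.reindex_bij_witness[of _ "\<lambda>w. w + u" "\<lambda>w. w - u"])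
      (use u assms in \<open>auto intro: subgp_add subgp_diff\<close>)
  also have "\<dots> = ?s * mod_ring_char (B v u)"
    by (simp add: B_add mod_ring_char_add sum_distrib_right)
  finally have "?s * (1 - mod_ring_char (B v u)) = 0"
    by (simp add: algebra_simps)
  with u(2) have "?s = 0"
    by (auto simp: mod_ring_char_eq_1_iff)
  then show ?thesis unfolding if_not_P[OF False] .
qed simp

lemma char_sum_G:
  assumes "x \<in> G"
  shows "(\<Sum>v\<in>G. mod_ring_char (B v x)) = (if x = 0 then of_nat (card G) else 0)"
proof -
  have "(\<Sum>v\<in>G. mod_ring_char (B v x)) = (\<Sum>v\<in>G. mod_ring_char (B x v))"
    by (simp add: B_sym)
  also have "\<dots> = (if x = 0 then of_nat (card G) else 0)"
    using B_nondeg[OF assms] by (auto simp: char_sum[OF subgp_G])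
  finally show ?thesis .
qed

text \<open>Double counting: the sum of all characters over \<open>G\<close> and \<open>W\<close> is
  evaluated by orthogonality in either variable first.\<close>

lemma card_perp:
  assumes "subgp W"
  shows "card W * card (perp W) = card G"
proof -
  have "of_nat (card W * card (perp W)) = (\<Sum>v\<in>G. \<Sum>w\<in>W. mod_ring_char (B v w))"
    by (simp add: char_sum[OF assms] sum.If_cases[OF finite_G] perp_def Int_def mult.commute)
  also have "\<dots> = (\<Sum>w\<in>W. \<Sum>v\<in>G. mod_ring_char (B v w))"
    by (rule sum.swap)
  also have "\<dots> = (\<Sum>w\<in>W. if w = 0 then of_nat (card G) else 0)"
    using assms by (intro sum.cong) (auto simp: char_sum_G subgp_def)
  also have "\<dots> = of_nat (card G)"
    using assms subgp_finite[OF assms] by (simp add: subgp_def)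
  finally show ?thesis
    by (simp only: of_nat_eq_iff)
qed

lemma perp_perp:
  assumes "subgp W"
  shows "perp (perp W) = W"
proof -
  have W: "W \<subseteq> perp (perp W)"
    using assms B_sym by (auto simp: perp_def subgp_def)
  have "card W * card (perp W) = card (perp (perp W)) * card (perp W)"
    using card_perp[OF assms] card_perp[OF subgp_perp[OF assms]] by (simp add: mult.commute)
  then have "card W = card (perp (perp W))"
    using subgp_card_pos[OF subgp_perp[OF assms]] by simp
  then show ?thesis
    using card_subset_eq[OF _ W] subgp_finite[OF subgp_perp[OF subgp_perp[OF assms]]] by metis
qed

text \<open>A nonzero value \<open>B v u\<close> is invertible mod p, so the integer multiples of
  \<open>u\<close> already realise every value.\<close>

lemma pairing_surj:
  assumes "subgp W" "v \<in> G" "v \<notin> perp W"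
  shows "\<exists>w\<in>W. B v w = c"
proof -
  from assms obtain u where u: "u \<in> W" "B v u \<noteq> 0" by (auto simp: perp_def)
  define k where "k = nat (to_int_mod_ring (c / B v u))"
  have k: "of_nat k = c / B v u"
    using to_int_mod_ring_bounds[of "c / B v u"]
    by (simp add: k_def of_nat_of_int_mod_ring)
  have "\<exists>w\<in>W. B v w = of_nat n * B v u" for n
  proof (induction n)
    case 0
    then show ?case using assms by (intro bexI[of _ 0]) (auto simp: subgp_def)
  next
    case (Suc n)
    then obtain w where "w \<in> W" "B v w = of_nat n * B v u" by blast
    then have "B v (w + u) = of_nat (Suc n) * B v u" "w + u \<in> W"
      using subgp_add[OF assms(1) _ u(1)] by (auto simp: B_add distrib_right)
    then show ?case by blast
  qed
  from this[of k] show ?thesis using u k by auto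
qed

text \<open>The p fibres of \<open>B v\<close> on \<open>W\<close> are all nonempty, hence
  translates of the kernel.\<close>

lemma card_kernel:
  assumes "subgp W" "v \<in> G" "v \<notin> perp W"
  shows "card W = CARD('p) * card {w \<in> W. B v w = 0}"
proof -
  have eq: "card {w \<in> W. B v w = c} = card {w \<in> W. B v w = 0}" for c
  proof -
    obtain u where u: "u \<in> W" "B v u = c" using pairing_surj[OF assms] by blast
    show ?thesis
      by (rule bij_betw_same_card[of "\<lambda>w. w - u"], rule bij_betw_byWitness[of _ "\<lambda>w. w + u"])
        (use u assms(1) in \<open>auto simp: B_diff B_add intro: subgp_diff subgp_add\<close>)
  qed
  have "card W = (\<Sum>c\<in>UNIV. card {w \<in> W. B v w = c})"
    using sum.group[OF subgp_finite[OF assms(1)], of "UNIV :: 'p mod_ring set" "B v" "\<lambda>_. 1::nat"]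
    by simp
  also have "\<dots> = (\<Sum>c\<in>(UNIV :: 'p mod_ring set). card {w \<in> W. B v w = 0})"
    by (rule sum.cong[OF refl eq])
  finally show ?thesis by simp
qed

section \<open>Fourier transform of a set, threefold sums and the density increment\<close>

definition fourier :: "'a set \<Rightarrow> 'a \<Rightarrow> complex" where
  "fourier A v = (\<Sum>a\<in>A. mod_ring_char (B v a))"

text \<open>After expanding the square, orthogonality over the frequencies keeps only the diagonal
  terms.\<close>

lemma parseval:
  assumes "A \<subseteq> G"
  shows "(\<Sum>v\<in>G. (norm (fourier A v))\<^sup>2) = card G * card A"
proof -
  have fin: "finite A" using assms finite_G finite_subset by blast
  have "of_real (\<Sum>v\<in>G. (norm (fourier A v))\<^sup>2)
    = (\<Sum>v\<in>G. \<Sum>a\<in>A. \<Sum>b\<in>A. mod_ring_char (B v (a - b)))"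
    unfolding fourier_def of_real_sum complex_norm_square cnj_sum sum_product
    by (simp add: cnj_mod_ring_char B_minus B_add flip: mod_ring_char_add diff_conv_add_uminus B_diff)
  also have "\<dots> = (\<Sum>a\<in>A. \<Sum>b\<in>A. \<Sum>v\<in>G. mod_ring_char (B v (a - b)))"
    by (subst sum.swap, rule sum.cong[OF refl], rule sum.swap)
  also have "\<dots> = (\<Sum>a\<in>A. \<Sum>b\<in>A. if b = a then of_nat (card G) else 0)"
    by (intro sum.cong refl, subst char_sum_G) (use assms diff_G in auto)
  also have "\<dots> = of_real (card G * card A)"
    using fin by (simp add: mult.commute)
  finally show ?thesis
    by (simp only: of_real_eq_iff)
qed

text \<open>Circle method: the frequencies in \<open>perp W\<close> give a main term
  \<open>card (perp W) * card A ^ 3\<close> to the number of representations of \<open>t\<close>,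
  scaled by \<open>card G\<close>. The other frequencies are too small to cancel it.\<close>

lemma threefold_sum:
  fixes \<eta> :: real
  assumes W: "subgp W" and x: "x \<in> G" and A: "\<And>a. a \<in> A \<Longrightarrow> a - x \<in> W"
    and unif: "\<And>v. v \<in> G \<Longrightarrow> v \<notin> perp W \<Longrightarrow> norm (fourier A v) \<le> \<eta> * card W"
    and dens: "\<eta> * (card W)\<^sup>2 < (card A)\<^sup>2" and "\<eta> \<ge> 0"
    and t: "t - (x + x + x) \<in> W"
  shows "\<exists>a\<in>A. \<exists>b\<in>A. \<exists>c\<in>A. t = a + b + c"
proof (rule ccontr)
  assume none: "\<not> ?thesis"
  have addG: "u + v \<in> G" if "u \<in> G" "v \<in> G" for u v
    using subgp_add[OF subgp_G] that by blast
  have "t - (x + x + x) + (x + x + x) \<in> G"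
    using t W x unfolding subgp_def by (blast intro: addG)
  then have tG: "t \<in> G" by simp
  have AG: "A \<subseteq> G"
  proof
    fix a assume "a \<in> A"
    then have "(a - x) + x \<in> G" using A W x unfolding subgp_def by (blast intro: addG)
    then show "a \<in> G" by simp
  qed
  then have fin: "finite A" using finite_G finite_subset by blast
  \<comment> \<open>By orthogonality the sum of \<open>F\<close> over \<open>G\<close> is
    \<open>card G\<close> times the number of triples in \<open>A\<close> with sum \<open>t\<close>,
    which is assumed to be zero.\<close>
  define F where "F v = fourier A v ^ 3 * mod_ring_char (- B v t)" for v
  have "(\<Sum>v\<in>G. F v) = (\<Sum>v\<in>G. \<Sum>a\<in>A. \<Sum>b\<in>A. \<Sum>c\<in>A. mod_ring_char (B v (a + b + c - t)))"
    unfolding F_def fourier_def power3_eq_cube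
    by (simp add: sum_distrib_left sum_distrib_right B_add B_minus mod_ring_char_add
        diff_conv_add_uminus mult_ac del: add_uminus_conv_diff)
  also have "\<dots> = (\<Sum>a\<in>A. \<Sum>b\<in>A. \<Sum>c\<in>A. \<Sum>v\<in>G. mod_ring_char (B v (a + b + c - t)))"
    by (subst sum.swap, rule sum.cong[OF refl], subst sum.swap, rule sum.cong[OF refl], rule sum.swap)
  also have "\<dots> = 0"
  proof -
    have "(\<Sum>v\<in>G. mod_ring_char (B v (a + b + c - t))) = 0"
      if abc: "a \<in> A" "b \<in> A" "c \<in> A" for a b c
    proof -
      have "a + b + c - t \<in> G" using abc AG tG by (blast intro: addG diff_G)
      moreover have "a + b + c - t \<noteq> 0" using none abc by auto
      ultimately show ?thesis by (simp add: char_sum_G)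
    qed
    then show ?thesis by simp
  qed
  finally have zero: "(\<Sum>v\<in>G. F v) = 0" .
  \<comment> \<open>A character trivial on \<open>W\<close> is constant on \<open>x + W\<close>, and
    its phases at the three summands cancel against the phase at \<open>t\<close>.\<close>
  have main: "F v = of_nat (card A) ^ 3" if "v \<in> perp W" for v
  proof -
    have "B v a = B v x" if "a \<in> A" for a
      using A[OF that] \<open>v \<in> perp W\<close> by (auto simp: perp_def B_diff)
    then have "fourier A v = of_nat (card A) * mod_ring_char (B v x)"
      by (simp add: fourier_def)
    moreover have "B v t = B v x + B v x + B v x"
      using t that by (auto simp: perp_def B_diff B_add)
    ultimately have "F v = of_nat (card A) ^ 3 * mod_ring_char (B v t + - B v t)"
      unfolding F_def by (simp only: mod_ring_char_add power_mult_distrib power3_eq_cube mult_ac)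
    then show ?thesis
      by simp
  qed
  have PG: "perp W \<subseteq> G" by (auto simp: perp_def)
  have "(\<Sum>v\<in>G. F v) = (\<Sum>v\<in>G - perp W. F v) + (\<Sum>v\<in>perp W. F v)"
    using sum.subset_diff[OF PG finite_G] .
  then have "of_nat (card (perp W) * card A ^ 3) = - (\<Sum>v\<in>G - perp W. F v)"
    using zero main by (simp add: eq_neg_iff_add_eq_0 add.commute)
  then have "real (card (perp W) * card A ^ 3) = norm (\<Sum>v\<in>G - perp W. F v)"
    by (metis norm_minus_cancel norm_of_nat)
  also have "\<dots> \<le> (\<Sum>v\<in>G - perp W. norm (F v))"
    by (rule norm_sum)
  \<comment> \<open>One of the three Fourier factors is bounded by uniformity; the other two are
    left for Parseval.\<close>
  also have "\<dots> \<le> (\<Sum>v\<in>G - perp W. \<eta> * card W * (norm (fourier A v))\<^sup>2)"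
  proof (rule sum_mono)
    fix v assume v: "v \<in> G - perp W"
    have "norm (F v) = norm (fourier A v) * (norm (fourier A v))\<^sup>2"
      by (simp add: F_def norm_mult norm_power power3_eq_cube power2_eq_square)
    also have "\<dots> \<le> \<eta> * card W * (norm (fourier A v))\<^sup>2"
      using unif v by (intro mult_right_mono) auto
    finally show "norm (F v) \<le> \<eta> * card W * (norm (fourier A v))\<^sup>2" .
  qed
  also have "\<dots> \<le> (\<Sum>v\<in>G. \<eta> * card W * (norm (fourier A v))\<^sup>2)"
    using finite_G \<open>\<eta> \<ge> 0\<close> by (intro sum_mono2) auto
  also have "\<dots> = \<eta> * card W * (card G * card A)"
    using parseval[OF AG] by (simp flip: sum_distrib_left)
  also have "\<dots> = card A * (card (perp W) * (\<eta> * (card W)\<^sup>2))"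
    by (simp flip: card_perp[OF W] add: power2_eq_square)
  also have "\<dots> < card A * (card (perp W) * (card A)\<^sup>2)"
  proof -
    have "(real (card A))\<^sup>2 > 0"
      using dens mult_nonneg_nonneg[OF \<open>\<eta> \<ge> 0\<close> zero_le_power2[of "real (card W)"]]
      unfolding of_nat_power by (rule le_less_trans[rotated])
    then have "card A \<noteq> 0"
      by (intro notI) simp
    then show ?thesis
      using dens subgp_card_pos[OF subgp_perp[OF W]] by (simp del: of_nat_power)
  qed
  finally show False
    by (simp add: power3_eq_cube power2_eq_square mult_ac)
qed

text \<open>Take a coset maximising density minus \<open>\<eta>\<close> times the codimension
  \<open>m\<close>. Comparison with the whole group gives the density bound. Comparison with cosets
  of the index-p subgroup cut out by a frequency \<open>v\<close> gives uniformity at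
  \<open>v\<close>.\<close>

lemma dense_coset:
  fixes \<eta> :: real
  assumes A: "A \<subseteq> G" and "\<eta> \<ge> 0"
  obtains W x m where "subgp W" "x \<in> G" "CARD('p) ^ m * card W = card G"
    "card A / card G + \<eta> * m \<le> card {a \<in> A. a - x \<in> W} / card W"
    "\<And>v. v \<in> G \<Longrightarrow> v \<notin> perp W \<Longrightarrow> norm (fourier {a \<in> A. a - x \<in> W} v) \<le> \<eta> * card W"
proof -
  define X where "X = {(m, W, x). subgp W \<and> x \<in> G \<and> CARD('p) ^ m * card W = card G}"
  define \<Phi> where "\<Phi> = (\<lambda>(m, W, x). card {a \<in> A. a - x \<in> W} / card W - \<eta> * real m)"
  have p1: "CARD('p) > 1" by (rule nontriv)
  \<comment> \<open>The codimension is bounded because m \<le> p^m \<le> \<open>card G\<close>; so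
    finitely many candidates remain and a maximum exists.\<close>
  have "X \<subseteq> {..card G} \<times> Pow G \<times> G"
  proof (clarsimp simp: X_def)
    fix m W x assume W: "subgp W" "CARD('p) ^ m * card W = card G"
    have "m \<le> CARD('p) ^ m" using p1 less_exp[of m] power_mono[of 2 "CARD('p)" m] by auto
    also have "\<dots> \<le> card G" using W subgp_card_pos[OF W(1)]
      by (metis dvd_imp_le dvd_triv_left subgp_G subgp_card_pos)
    finally show "m \<le> card G \<and> W \<subseteq> G" using W by (simp add: subgp_def)
  qed
  then have fin: "finite X"
    using finite_G finite_subset by blast
  have base: "(0, G, 0) \<in> X"
    using subgp_G zero_G by (simp add: X_def)
  have "Max (\<Phi> ` X) \<in> \<Phi> ` X"
    using fin base by (intro Max_in) auto
  then obtain m W x where mWx: "(m, W, x) \<in> X" "\<Phi> (m, W, x) = Max (\<Phi> ` X)" by auto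
  have max: "\<Phi> y \<le> \<Phi> (m, W, x)" if "y \<in> X" for y
    using fin that by (simp add: mWx)
  have W: "subgp W" and x: "x \<in> G" and m: "CARD('p) ^ m * card W = card G"
    using mWx(1) by (auto simp: X_def)
  define A' where "A' = {a \<in> A. a - x \<in> W}"
  have finA': "finite A'" using A finite_G finite_subset unfolding A'_def by fastforce
  have "{a \<in> A. a - 0 \<in> G} = A" using A by auto
  then have dens: "card A / card G + \<eta> * m \<le> card A' / card W"
    using max[OF base] by (simp add: \<Phi>_def A'_def)
  have unif: "norm (fourier A' v) \<le> \<eta> * card W" if v: "v \<in> G" "v \<notin> perp W" for v
  proof -
    define K where "K = {w \<in> W. B v w = 0}"
    have K: "subgp K" unfolding K_def by (rule subgp_kernel[OF W])
    have cK: "card W = CARD('p) * card K" unfolding K_def by (rule card_kernel[OF W v])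
    \<comment> \<open>Maximality allows any coset of \<open>K\<close>, whose codimension is one
      larger, at most this many points of \<open>A\<close>.\<close>
    define \<beta> where "\<beta> = (card A' / card W + \<eta>) * card K"
    define n where "n c = card {a \<in> A'. B v (a - x) = c}" for c
    have n: "real (n c) \<le> \<beta>" for c
    proof -
      obtain u where u: "u \<in> W" "B v u = c" using pairing_surj[OF W v] by blast
      have xu: "x + u \<in> G" using x u W subgp_add[OF subgp_G] by (auto simp: subgp_def)
      have "(Suc m, K, x + u) \<in> X"
        using K xu m cK by (simp add: X_def mult_ac)
      from max[OF this]
      have "card {a \<in> A. a - (x + u) \<in> K} / card K \<le> card A' / card W + \<eta>"
        by (simp add: \<Phi>_def A'_def algebra_simps)
      then have "card {a \<in> A. a - (x + u) \<in> K} \<le> \<beta>"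
        using subgp_card_pos[OF K] by (simp add: \<beta>_def field_simps)
      moreover have "{a \<in> A'. B v (a - x) = c} \<subseteq> {a \<in> A. a - (x + u) \<in> K}"
        using u subgp_diff[OF W] by (auto simp: A'_def K_def diff_diff_add[symmetric] B_diff)
      ultimately show ?thesis
        unfolding n_def using card_mono[of "{a \<in> A. a - (x + u) \<in> K}" "{a \<in> A'. B v (a - x) = c}"]
          finite_subset[OF A finite_G] by simp
    qed
    have "fourier A' v = (\<Sum>c\<in>UNIV. \<Sum>a\<in>{a\<in>A'. B v (a - x) = c}. mod_ring_char (B v a))"
      using sum.group[OF finA', of "UNIV :: 'p mod_ring set" "\<lambda>a. B v (a - x)"
          "\<lambda>a. mod_ring_char (B v a)"]
      by (simp add: fourier_def)
    also have "\<dots> = (\<Sum>c\<in>UNIV. of_nat (n c) * (mod_ring_char c * mod_ring_char (B v x)))"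
    proof (intro sum.cong refl)
      fix c
      have "(\<Sum>a\<in>{a\<in>A'. B v (a - x) = c}. mod_ring_char (B v a))
        = (\<Sum>a\<in>{a\<in>A'. B v (a - x) = c}. mod_ring_char c * mod_ring_char (B v x))"
        by (intro sum.cong refl) (auto simp: B_diff simp flip: mod_ring_char_add)
      then show "(\<Sum>a\<in>{a\<in>A'. B v (a - x) = c}. mod_ring_char (B v a))
        = of_nat (n c) * (mod_ring_char c * mod_ring_char (B v x))"
        by (simp add: n_def)
    qed
    also have "\<dots> = mod_ring_char (B v x) * (\<Sum>c\<in>UNIV. of_real (real (n c)) * mod_ring_char c)"
      by (simp add: sum_distrib_left mult_ac)
    \<comment> \<open>The characters sum to zero over \<open>\<int>/p\<int>\<close>, so only the deficits \<open>\<beta> - n c\<close>, which are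
      nonnegative by maximality, contribute.\<close>
    also have "(\<Sum>c\<in>UNIV. of_real (real (n c)) * mod_ring_char (c :: 'p mod_ring))
      = - (\<Sum>c\<in>UNIV. of_real (\<beta> - n c) * mod_ring_char c)"
      using sum_mod_ring_char[where ?'p = 'p]
      by (simp add: left_diff_distrib sum_subtractf flip: sum_distrib_left)
    finally have "norm (fourier A' v) = norm (\<Sum>c\<in>UNIV. of_real (\<beta> - n c) * mod_ring_char c)"
      by (simp add: norm_mult del: of_real_diff)
    also have "\<dots> \<le> (\<Sum>c\<in>UNIV. norm (of_real (\<beta> - n c) * mod_ring_char c :: complex))"
      by (rule norm_sum)
    also have "\<dots> = (\<Sum>c\<in>(UNIV :: 'p mod_ring set). \<beta> - n c)"
      using n by (intro sum.cong refl) (simp add: norm_mult del: of_real_diff)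
    also have "\<dots> = CARD('p) * \<beta> - (\<Sum>c\<in>UNIV. n c)"
      by (simp add: sum_subtractf)
    also have "(\<Sum>c\<in>UNIV. n c) = card A'"
      using sum.group[OF finA', of "UNIV :: 'p mod_ring set" "\<lambda>a. B v (a - x)" "\<lambda>_. 1::nat"]
      by (simp add: n_def)
    \<comment> \<open>As \<open>K\<close> has index p in \<open>W\<close>, the deficits add up to
      exactly \<open>\<eta> * card W\<close>.\<close>
    also have "CARD('p) * \<beta> = (card A' / card W + \<eta>) * card W"
      by (simp add: \<beta>_def cK)
    also have "\<dots> = card A' + \<eta> * card W"
      using subgp_card_pos[OF W] by (simp add: distrib_right)
    finally show ?thesis by linarith
  qed
  show ?thesis
    by (rule that[OF W x m dens[unfolded A'_def] unif[unfolded A'_def]])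
qed

lemma card_coset_le:
  assumes "subgp W" "A \<subseteq> G"
  shows "card {a \<in> A. a - x \<in> W} \<le> card W"
  by (rule card_inj_on_le[of "\<lambda>a. a - x"]) (use assms subgp_finite in \<open>auto simp: inj_on_def\<close>)

end

section \<open>Monochromatic sums in finite levels\<close>

text \<open>The first argument may have infinite support: limits of functionals in the compactness
  argument below need not be finitely supported.\<close>

definition dot :: "(nat \<Rightarrow> 'p mod_ring) \<Rightarrow> 'p::prime_card Fp_omega \<Rightarrow> 'p mod_ring" where
  "dot u x = (\<Sum>i\<in>Poly_Mapping.keys x. u i * Poly_Mapping.lookup x i)"

definition level :: "nat \<Rightarrow> 'p::prime_card Fp_omega set" where
  "level n = {x. Poly_Mapping.keys x \<subseteq> {..<n}}"

text \<open>Extends maps on the coordinates to the direct sum. Keys that cancel in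
  \<open>x + y\<close> do no harm since \<open>h i 0 = 0\<close>.\<close>

lemma additive_sum_keys:
  assumes "\<And>i. additive (h i)"
  shows "additive (\<lambda>x. \<Sum>i\<in>Poly_Mapping.keys x. h i (Poly_Mapping.lookup x i))"
proof
  show "(\<Sum>i\<in>Poly_Mapping.keys (x + y). h i (Poly_Mapping.lookup (x + y) i))
    = (\<Sum>i\<in>Poly_Mapping.keys x. h i (Poly_Mapping.lookup x i)) + (\<Sum>i\<in>Poly_Mapping.keys y. h i (Poly_Mapping.lookup y i))" for x y
    by (rule setsum_keys_plus_distrib) (simp_all add: additive.zero[OF assms] additive.add[OF assms])
qed

lemma additive_dot: "additive (dot u)"
  unfolding dot_def by (rule additive_sum_keys) (simp add: additive_def distrib_left)

lemma dot_commute: "dot (Poly_Mapping.lookup x) y = dot (Poly_Mapping.lookup y) x"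
proof -
  have *: "dot (Poly_Mapping.lookup x) y = (\<Sum>i\<in>Poly_Mapping.keys x \<inter> Poly_Mapping.keys y. Poly_Mapping.lookup x i * Poly_Mapping.lookup y i)" for x y :: "'a Fp_omega"
    unfolding dot_def by (rule sum.mono_neutral_right) (auto simp: in_keys_iff)
  show ?thesis
    unfolding *[of x y] *[of y x] by (rule sum.cong) (auto simp: mult.commute)
qed

lemma level_iff: "x \<in> level n \<longleftrightarrow> (\<forall>i\<ge>n. Poly_Mapping.lookup x i = 0)"
  unfolding level_def subset_iff in_keys_iff by (simp, meson not_le)

lemma finite_level: "finite (level n)"
proof (rule finite_imageD)
  have "Poly_Mapping.lookup ` level n \<subseteq> {f. \<forall>i. (i \<in> {..<n} \<longrightarrow> f i \<in> UNIV) \<and> (i \<notin> {..<n} \<longrightarrow> f i = 0)}"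
    by (auto simp: level_iff)
  then show "finite (Poly_Mapping.lookup ` level n)"
    by (rule finite_subset) (rule finite_set_of_finite_funs; simp)
  show "inj_on Poly_Mapping.lookup (level n)"
    by (simp add: inj_on_def lookup_inject)
qed

lemma finite_pairing_level: "finite_pairing (level n) (\<lambda>x. dot (Poly_Mapping.lookup x))"
proof
  show "finite (level n)" by (rule finite_level)
  show "0 \<in> level n" by (simp add: level_iff)
  show "x - y \<in> level n" if "x \<in> level n" "y \<in> level n" for x y
    using that by (simp add: level_iff lookup_minus)
  show "dot (Poly_Mapping.lookup x) (y + z) = dot (Poly_Mapping.lookup x) y + dot (Poly_Mapping.lookup x) z" for x y z
    by (rule additive.add[OF additive_dot])
  show "dot (Poly_Mapping.lookup x) y = dot (Poly_Mapping.lookup y) x" for x y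
    by (rule dot_commute)
  show "\<exists>y\<in>level n. dot (Poly_Mapping.lookup x) y \<noteq> 0" if "x \<in> level n" "x \<noteq> 0" for x
  proof -
    obtain i where i: "i \<in> Poly_Mapping.keys x"
      using \<open>x \<noteq> 0\<close> by (metis ex_in_conv keys_eq_empty)
    then have "Poly_Mapping.single i 1 \<in> level n"
      using \<open>x \<in> level n\<close> by (auto simp: level_def)
    moreover have "dot (Poly_Mapping.lookup x) (Poly_Mapping.single i 1) \<noteq> 0"
      using i by (simp add: dot_def in_keys_iff)
    ultimately show ?thesis by blast
  qed
qed

text \<open>Polynomial mappings carry a convolution product with unit \<open>single 0 1\<close>;
  multiplication by \<open>of_nat d\<close> is thus the d-fold sum.\<close>

lemma of_nat_Fp_omega_eq_0:
  assumes "CARD('p::prime_card) dvd d"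
  shows "(of_nat d :: 'p Fp_omega) = 0"
proof -
  from assms obtain k where "d = CARD('p) * k" by blast
  then have "(of_nat d :: 'p mod_ring) = 0" by simp
  then show ?thesis by (metis single_of_nat single_zero)
qed

text \<open>The number \<open>M\<close> of linear conditions must not depend on \<open>n\<close>.
  The conditions say that \<open>s\<close> lies in the subspace \<open>W\<close> supplied by
  \<open>dense_coset\<close> for a densest colour class.\<close>

lemma monochromatic_sums:
  fixes \<kappa> :: "'p::prime_card Fp_omega \<Rightarrow> 'c"
  assumes C: "finite C" "range \<kappa> \<subseteq> C" and d: "d > 2" "CARD('p) dvd d"
  shows "\<exists>M\<ge>(1::nat). \<forall>n. \<exists>U c. \<forall>s\<in>level n. (\<forall>j\<in>{1..M}. dot (U j) s = 0) \<longrightarrow>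
    (\<exists>xs. length xs = d \<and> sum_list xs = s \<and> (\<forall>x\<in>set xs. \<kappa> x = c))"
proof -
  define r where "r = card C"
  have r: "r > 0" using C by (auto simp: r_def card_gt_0_iff)
  \<comment> \<open>A density of at least 1/r on the coset makes this \<open>\<eta>\<close> small
    enough for \<open>threefold_sum\<close>, and a density of at most 1 forces m \<le> 2
    r^2.\<close>
  define \<eta> :: real where "\<eta> = 1 / (2 * r\<^sup>2)"
  have \<eta>: "\<eta> > 0" using r by (simp add: \<eta>_def)
  have p1: "CARD('p) \<ge> 1" by simp
  show ?thesis
  \<comment> \<open>This bounds \<open>card (perp W)\<close>, which equals p^m.\<close>
  proof (rule exI[of _ "CARD('p) ^ (2 * r\<^sup>2)"], rule conjI[OF _ allI])
    show "CARD('p) ^ (2 * r\<^sup>2) \<ge> 1" using p1 by simp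
    fix n
    let ?G = "level n :: 'p Fp_omega set"
    interpret finite_pairing ?G "\<lambda>x. dot (Poly_Mapping.lookup x)" by (rule finite_pairing_level)
    have "\<exists>c\<in>C. card ?G / r \<le> card {x \<in> ?G. \<kappa> x = c}"
    proof (rule ccontr)
      assume "\<not> ?thesis"
      then have "(\<Sum>c\<in>C. real (card {x \<in> ?G. \<kappa> x = c})) < of_nat (card C) * (card ?G / r)"
        using r by (intro sum_bounded_above_strict) (auto simp: r_def)
      moreover have "(\<Sum>c\<in>C. card {x \<in> ?G. \<kappa> x = c}) = card ?G"
        using sum.group[OF finite_level C(1), of \<kappa> n "\<lambda>_. 1::nat"] C(2) by auto
      ultimately show False using r by (simp add: r_def flip: of_nat_sum)
    qed
    then obtain c where c: "card ?G / r \<le> card {x \<in> ?G. \<kappa> x = c}" by blast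
    define A where "A = {x \<in> ?G. \<kappa> x = c}"
    have AG: "A \<subseteq> ?G" by (auto simp: A_def)
    obtain W x m where W: "subgp W" and x: "x \<in> ?G" and m: "CARD('p) ^ m * card W = card ?G"
      and dens: "card A / card ?G + \<eta> * m \<le> card {a \<in> A. a - x \<in> W} / card W"
      and unif: "\<And>v. v \<in> ?G \<Longrightarrow> v \<notin> perp W \<Longrightarrow> norm (fourier {a \<in> A. a - x \<in> W} v) \<le> \<eta> * card W"
      by (rule dense_coset[OF AG less_imp_le[OF \<eta>]], rule that)
    define A' where "A' = {a \<in> A. a - x \<in> W}"
    have W0: "card W > 0" using W by (rule subgp_card_pos)
    have "card A' \<le> card W" unfolding A'_def by (rule card_coset_le[OF W AG])
    have G0: "card ?G > 0" by (rule subgp_card_pos[OF subgp_G])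
    have ratio: "card A / card ?G \<ge> 1 / r"
      using c r G0 by (simp add: A_def field_simps)
    have A'_ge: "1 / r + \<eta> * m \<le> card A' / card W"
      using dens ratio by (simp add: A'_def)
    have "card A' / card W \<le> 1"
      using \<open>card A' \<le> card W\<close> W0 by simp
    moreover have "0 \<le> 1 / real r" by simp
    ultimately have "\<eta> * m \<le> 1"
      using A'_ge by linarith
    then have "real m \<le> real (2 * r\<^sup>2)"
      using r by (simp add: \<eta>_def field_simps)
    then have m_le: "m \<le> 2 * r\<^sup>2" by (simp only: of_nat_le_iff)
    have "0 \<le> \<eta> * m" using \<eta> by simp
    with A'_ge have "1 / r \<le> card A' / card W" by linarith
    then have "card W \<le> r * real (card A')"
      using r W0 by (simp add: field_simps)
    then have "(real (card W))\<^sup>2 \<le> (r * real (card A'))\<^sup>2"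
      by (rule power_mono) simp
    then have "\<eta> * (real (card W))\<^sup>2 \<le> \<eta> * (r * real (card A'))\<^sup>2"
      using \<eta> by simp
    also have "\<dots> = (real (card A'))\<^sup>2 / 2"
      using r by (simp add: \<eta>_def power_mult_distrib)
    also have "\<dots> < (real (card A'))\<^sup>2"
      using \<open>card W \<le> r * real (card A')\<close> W0 by (cases "card A' = 0") auto
    finally have small: "\<eta> * (card W)\<^sup>2 < (card A')\<^sup>2" by simp
    have "card A' \<noteq> 0"
      using \<open>card W \<le> r * real (card A')\<close> W0 by (intro notI) simp
    then have "A' \<noteq> {}" by (intro notI) simp
    then obtain a0 where a0: "a0 \<in> A'" by blast
    have "card W * card (perp W) = card W * CARD('p) ^ m"
      unfolding card_perp[OF W] m[symmetric] by (rule mult.commute)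
    then have perp_le: "card (perp W) \<le> CARD('p) ^ (2 * r\<^sup>2)"
      using W0 m_le p1 by (simp add: power_increasing)
    obtain h where h: "bij_betw h {1..card (perp W)} (perp W)"
      using ex_bij_betw_nat_finite_1[OF subgp_finite[OF subgp_perp[OF W]]] by blast
    have mult_W: "of_nat k * w \<in> W" if "w \<in> W" for k w
    proof (induction k)
      case 0
      show ?case using W by (simp add: subgp_def)
    next
      case (Suc k)
      show ?case using subgp_add[OF W that Suc] by (simp add: distrib_right)
    qed
    show "\<exists>U c. \<forall>s\<in>?G. (\<forall>j\<in>{1..CARD('p) ^ (2 * r\<^sup>2)}. dot (U j) s = 0) \<longrightarrow>
      (\<exists>xs. length xs = d \<and> sum_list xs = s \<and> (\<forall>x\<in>set xs. \<kappa> x = c))"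
    \<comment> \<open>The functionals enumerate \<open>perp W\<close>. Indices beyond
      \<open>card (perp W)\<close> carry arbitrary values of \<open>h\<close>, which only impose
      further conditions on \<open>s\<close>.\<close>
    proof (rule exI[of _ "\<lambda>j. Poly_Mapping.lookup (h j)"], rule exI[of _ c], intro ballI impI)
      fix s assume s: "s \<in> ?G" "\<forall>j\<in>{1..CARD('p) ^ (2 * r\<^sup>2)}. dot (Poly_Mapping.lookup (h j)) s = 0"
      have "dot (Poly_Mapping.lookup s) v = 0" if "v \<in> perp W" for v
      proof -
        have "v \<in> h ` {1..card (perp W)}"
          using that unfolding bij_betw_imp_surj_on[OF h] .
        then obtain j where "j \<in> {1..card (perp W)}" "v = h j"
          by blast
        then show ?thesis using s(2) perp_le by (simp add: dot_commute[of s])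
      qed
      then have "s \<in> perp (perp W)"
        using s(1) unfolding perp_def[of "perp W"] by blast
      then have "s \<in> W" by (simp add: perp_perp[OF W])
      \<comment> \<open>After d - 3 copies of \<open>a0\<close>, this is what three elements of
        \<open>A'\<close> have to contribute. It lies in the coset of 3 x because d x = 0.\<close>
      define t where "t = s - of_nat (d - 3) * a0"
      have "of_nat (d - 3) * x + (x + x + x) = of_nat (d - 3 + 3) * x"
        by (simp add: distrib_right)
      also have "\<dots> = 0"
        using of_nat_Fp_omega_eq_0[OF d(2)] d(1) by simp
      finally have "x + x + x = - (of_nat (d - 3) * x)"
        by (simp add: eq_neg_iff_add_eq_0 add.commute)
      then have "t - (x + x + x) = s - of_nat (d - 3) * (a0 - x)"
        by (simp add: t_def right_diff_distrib)
      also have "\<dots> \<in> W"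
        using a0 by (intro subgp_diff[OF W \<open>s \<in> W\<close>] mult_W) (simp add: A'_def)
      finally have t: "t - (x + x + x) \<in> W" .
      have "\<exists>a\<in>A'. \<exists>b\<in>A'. \<exists>c\<in>A'. t = a + b + c"
        by (rule threefold_sum[OF W x _ unif[folded A'_def] small less_imp_le[OF \<eta>] t])
          (simp add: A'_def)
      then obtain a b e where abe: "a \<in> A'" "b \<in> A'" "e \<in> A'" "t = a + b + e" by blast
      have "s = a + b + e + of_nat (d - 3) * a0"
        using abe(4) by (simp add: t_def algebra_simps)
      then have "sum_list ([a, b, e] @ replicate (d - 3) a0) = s"
        by (simp add: sum_list_replicate add.assoc)
      moreover have "\<forall>y\<in>set ([a, b, e] @ replicate (d - 3) a0). \<kappa> y = c"
        using abe(1-3) a0 by (simp add: A'_def A_def)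
      moreover have "length ([a, b, e] @ replicate (d - 3) a0) = d"
        using d(1) by simp
      ultimately show "\<exists>xs. length xs = d \<and> sum_list xs = s \<and> (\<forall>x\<in>set xs. \<kappa> x = c)"
        by blast
    qed
  qed
qed

section \<open>A finitary form of Bohr recurrence\<close>

text \<open>Compactness of sequences over a finite alphabet, by Koenig's argument: prefixes shared
  by infinitely many witnesses can always be prolonged.\<close>

lemma sequence_compactness:
  fixes P :: "nat \<Rightarrow> (nat \<Rightarrow> 'b) \<Rightarrow> bool"
  assumes "finite X"
    and ex: "\<And>n. \<exists>w. range w \<subseteq> X \<and> P n w"
    and mono: "\<And>m n w. m \<le> n \<Longrightarrow> P n w \<Longrightarrow> P m w"
    and local: "\<And>n w w'. (\<And>i. i < n \<Longrightarrow> w i = w' i) \<Longrightarrow> P n w \<Longrightarrow> P n w'"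
  shows "\<exists>w. \<forall>n. P n w"
proof -
  obtain W where W: "\<And>n. range (W n) \<subseteq> X" "\<And>n. P n (W n)"
    using ex by metis
  define Q where "Q n w \<longleftrightarrow> infinite {m. \<forall>i<n. W m i = w i}" for n w
  have step: "\<exists>w'. Q (Suc n) w' \<and> (\<forall>i<n. w' i = w i)" if "Q n w" for n w
  proof -
    let ?S = "{m. \<forall>i<n. W m i = w i}"
    have "finite ((\<lambda>m. W m n) ` ?S)"
      using W(1) by (intro finite_subset[OF _ \<open>finite X\<close>]) auto
    then obtain m0 where "infinite {m \<in> ?S. W m n = W m0 n}"
      using pigeonhole_infinite[of ?S "\<lambda>m. W m n"] \<open>Q n w\<close> by (auto simp: Q_def)
    moreover have "{m \<in> ?S. W m n = W m0 n} = {m. \<forall>i<Suc n. W m i = (w(n := W m0 n)) i}"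
      by (auto simp: less_Suc_eq)
    ultimately have "Q (Suc n) (w(n := W m0 n))" by (simp add: Q_def)
    then show ?thesis by (intro exI[of _ "w(n := W m0 n)"]) auto
  qed
  have "\<exists>v. \<forall>n. Q n (v n) \<and> (\<forall>i<n. v (Suc n) i = v n i)"
    by (rule dependent_nat_choice) (use step in \<open>auto simp: Q_def\<close>)
  then obtain v where v: "\<And>n. Q n (v n)" "\<And>n i. i < n \<Longrightarrow> v (Suc n) i = v n i"
    by blast
  \<comment> \<open>Entry \<open>i\<close> never changes after stage \<open>Suc i\<close>, so the
    diagonal is the common extension of all the prefixes.\<close>
  define w where "w i = v (Suc i) i" for i
  have vw: "v n i = w i" if "i < n" for n i
    using that
  proof (induction n)
    case (Suc n)
    then show ?case using v(2)[of i n] by (cases "i = n") (auto simp: w_def)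
  qed simp
  have "P n w" for n
  proof -
    \<comment> \<open>Some witness with index at least \<open>n\<close> agrees with \<open>w\<close>
      below \<open>n\<close>; monotonicity and locality then pass the property on to
      \<open>w\<close>.\<close>
    obtain m where m: "m \<ge> n" "\<forall>i<n. W m i = v n i"
      using v(1)[of n] unfolding Q_def infinite_nat_iff_unbounded_le by blast
    show ?thesis
      by (rule local[OF _ mono[OF m(1) W(2)]]) (use m(2) vw in auto)
  qed
  then show ?thesis by blast
qed

section \<open>Embedding the cyclic group into the circle, and finitary Bohr recurrence\<close>

definition circle_embed :: "'p::prime_card mod_ring \<Rightarrow> circle" where
  "circle_embed a = abs_circle (of_int (to_int_mod_ring a) / of_nat CARD('p))"

lemma additive_circle_embed: "additive (circle_embed :: 'p::prime_card mod_ring \<Rightarrow> circle)"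
proof
  fix a b :: "'p mod_ring"
  let ?p = "real CARD('p)" and ?m = "to_int_mod_ring a + to_int_mod_ring b"
  have "to_int_mod_ring (a + b) = ?m - int CARD('p) * (?m div int CARD('p))"
    unfolding to_int_mod_ring_add by (simp add: minus_mult_div_eq_mod)
  then have "real_of_int (to_int_mod_ring (a + b)) = of_int ?m - ?p * of_int (?m div int CARD('p))"
    by simp
  then have "real_of_int (to_int_mod_ring (a + b)) / ?p - (of_int (to_int_mod_ring a) / ?p
      + of_int (to_int_mod_ring b) / ?p) = of_int (- (?m div int CARD('p)))"
    by (simp add: diff_divide_distrib add_divide_distrib)
  then show "circle_embed (a + b) = circle_embed a + circle_embed b"
    unfolding circle_embed_def plus_circle.abs_eq circle.abs_eq_iff by (metis Ints_of_int)
qed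

text \<open>A fraction with denominator p that is not an integer has distance at least 1/p from the
  integers.\<close>

lemma circle_embed_small:
  assumes "circle_norm (circle_embed (a :: 'p::prime_card mod_ring)) < 1 / CARD('p)"
  shows "a = 0"
proof -
  let ?p = "real CARD('p)"
  let ?x = "of_int (to_int_mod_ring a) / ?p"
  have p: "?p > 0" by simp
  have "\<bar>?x - of_int (round ?x)\<bar> * ?p < 1"
    using assms p unfolding circle_embed_def circle_norm_attained(1) by (simp add: field_simps)
  moreover have "\<bar>?x - of_int (round ?x)\<bar> * ?p = \<bar>(?x - of_int (round ?x)) * ?p\<bar>"
    by (simp add: abs_mult)
  moreover have "(?x - of_int (round ?x)) * ?p
    = of_int (to_int_mod_ring a - round ?x * int CARD('p))"
    by (simp add: left_diff_distrib)
  ultimately have "\<bar>to_int_mod_ring a - round ?x * int CARD('p)\<bar> < 1"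
    by linarith
  then have "to_int_mod_ring a = round ?x * int CARD('p)" by linarith
  then have "to_int_mod_ring a mod int CARD('p) = 0" by (metis mod_mult_self2_is_0)
  then have "to_int_mod_ring a = 0"
    using to_int_mod_ring_bounds[of a] by simp
  then show ?thesis by simp
qed

text \<open>If every level had a counterexample, compactness would give \<open>M\<close> functionals
  on the whole group with no common zero in \<open>S\<close>. Bohr recurrence with \<epsilon> = 1/p
  excludes this.\<close>

lemma Bohr_recurrence_finitary:
  fixes S :: "'p::prime_card Fp_omega set"
  assumes S: "Bohr_recurrence S" and M: "M \<ge> 1"
  shows "\<exists>n. \<forall>U :: nat \<Rightarrow> _. \<exists>s\<in>S. s \<in> level n \<and> (\<forall>j\<in>{1..M}. dot (U j) s = 0)"
proof (rule ccontr)
  assume contr: "\<not> ?thesis"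
  \<comment> \<open>The functionals are stored transposed: \<open>w i\<close> collects the i-th
    coefficients of all of them.\<close>
  define P where "P n w \<longleftrightarrow> (\<forall>s\<in>S. s \<in> level n \<longrightarrow> (\<exists>j\<in>{1..M}. dot (\<lambda>i. w i j) s \<noteq> 0))"
    for n and w :: "nat \<Rightarrow> nat \<Rightarrow> 'p mod_ring"
  \<comment> \<open>Fixing the value 0 outside \<open>{1..M}\<close> makes the alphabet
    finite.\<close>
  let ?X = "{f :: nat \<Rightarrow> 'p mod_ring. \<forall>j. (j \<in> {1..M} \<longrightarrow> f j \<in> UNIV) \<and> (j \<notin> {1..M} \<longrightarrow> f j = 0)}"
  have "\<exists>w. \<forall>n. P n w"
  proof (rule sequence_compactness[of ?X])
    show "finite ?X" by (rule finite_set_of_finite_funs) simp_all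
    show "\<exists>w. range w \<subseteq> ?X \<and> P n w" for n
    proof -
      obtain U where "\<forall>s\<in>S. s \<in> level n \<longrightarrow> (\<exists>j\<in>{1..M}. dot (U j) s \<noteq> 0)"
        using contr by blast
      moreover have "(\<lambda>i. if j \<in> {1..M} then U j i else 0) = U j" if "j \<in> {1..M}" for j
        using that by simp
      ultimately have "P n (\<lambda>i j. if j \<in> {1..M} then U j i else 0)"
        unfolding P_def by metis
      then show ?thesis
        by (intro exI[of _ "\<lambda>i j. if j \<in> {1..M} then U j i else 0"]) auto
    qed
    show "P m w" if "m \<le> n" "P n w" for m n w
      using that by (simp add: P_def level_iff)
    show "P n w'" if "\<And>i. i < n \<Longrightarrow> w i = w' i" "P n w" for n w w'
    proof -
      have "dot (\<lambda>i. w i j) s = dot (\<lambda>i. w' i j) s" if "s \<in> level n" for s j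
        unfolding dot_def using \<open>\<And>i. i < n \<Longrightarrow> w i = w' i\<close> that
        by (intro sum.cong) (auto simp: level_def)
      then show ?thesis using \<open>P n w\<close> unfolding P_def by metis
    qed
  qed
  then obtain w where w: "P n w" for n by blast
  define \<rho> where "\<rho> g j = circle_embed (dot (\<lambda>i. w i j) g)" for g j
  have "torus_hom M \<rho>"
    by (simp add: torus_hom_def \<rho>_def additive_def additive.add[OF additive_dot]
        additive.add[OF additive_circle_embed])
  moreover have "1 / real CARD('p) > 0" by simp
  ultimately obtain s where s: "s \<in> S" "torus_norm M (\<rho> s) < 1 / CARD('p)"
    using S M unfolding Bohr_recurrence_def by blast
  have "dot (\<lambda>i. w i j) s = 0" if "j \<in> {1..M}" for j
  proof (rule circle_embed_small)
    have "circle_norm (\<rho> s j) \<le> torus_norm M (\<rho> s)"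
      unfolding torus_norm_def using that by (intro Max_ge) auto
    then show "circle_norm (circle_embed (dot (\<lambda>i. w i j) s)) < 1 / CARD('p)"
      using s(2) by (simp add: \<rho>_def)
  qed
  moreover obtain n where "s \<in> level n"
    using finite_nat_iff_bounded[of "Poly_Mapping.keys s"] by (auto simp: level_def)
  ultimately show False
    using w[of n] s(1) unfolding P_def by blast
qed

section \<open>Lifting along an endomorphism\<close>

lemma basis_sum_conv: "additive h \<Longrightarrow> h (basis_sum F) = (\<Sum>n\<in>F. h (Poly_Mapping.single n 1))"
  unfolding basis_sum_def by (rule additive.sum)

text \<open>Infinite fibres always leave an index not yet used, so even repeated summands lift to
  distinct indices.\<close>

lemma distinct_preimages:
  assumes "\<And>x. x \<in> set xs \<Longrightarrow> infinite {n :: nat. g n = x \<and> c n = a}"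
  shows "\<exists>F. finite F \<and> card F = length xs \<and> (\<Sum>n\<in>F. g n) = sum_list xs \<and> (\<forall>n\<in>F. c n = a)"
  using assms
proof (induction xs)
  case Nil
  show ?case by (intro exI[of _ "{}"]) simp
next
  case (Cons x xs)
  then obtain F where F: "finite F" "card F = length xs" "(\<Sum>n\<in>F. g n) = sum_list xs"
    "\<forall>n\<in>F. c n = a" by auto
  have "infinite {n. g n = x \<and> c n = a}" using Cons.prems by simp
  then have "\<not> {n. g n = x \<and> c n = a} \<subseteq> F"
    using F(1) finite_subset by blast
  then obtain n where "g n = x" "c n = a" "n \<notin> F"
    by blast
  with F show ?case by (intro exI[of _ "insert n F"]) auto
qed

section \<open>Torsion in the circle and a repeating enumeration of the group\<close>

lemma circle_sum_const: "(\<Sum>i<m. abs_circle r) = abs_circle (real m * r)"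
proof (induction m)
  case 0
  show ?case by (simp add: zero_circle.abs_eq)
next
  case (Suc m)
  have "(\<Sum>i<Suc m. abs_circle r) = abs_circle (real m * r) + abs_circle r"
    by (simp only: sum.lessThan_Suc Suc)
  also have "\<dots> = abs_circle (real m * r + r)" by (rule plus_circle.abs_eq)
  also have "real m * r + r = real (Suc m) * r" by (simp add: distrib_right)
  finally show ?case .
qed

text \<open>The p-torsion consists of the classes of m/p with 0 \<le> m < p. Hence a torus
  homomorphism takes only finitely many values on basis vectors.\<close>

lemma finite_circle_torsion:
  assumes "(p :: nat) > 0"
  shows "finite {c :: circle. (\<Sum>i<p. c) = 0}"
proof (rule finite_subset)
  show "{c. (\<Sum>i<p. c) = 0} \<subseteq> (\<lambda>m. abs_circle (of_int m / real p)) ` {0..<int p}"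
  proof
    fix c :: circle assume "c \<in> {c. (\<Sum>i<p. c) = 0}"
    moreover obtain r where r: "c = abs_circle r"
      using Quotient_abs_rep[OF Quotient_circle, of c, symmetric] by blast
    ultimately have "abs_circle (real p * r) = abs_circle 0"
      by (simp add: circle_sum_const zero_circle.abs_eq)
    then obtain k where k: "real p * r = of_int k"
      by (auto simp: circle.abs_eq_iff elim: Ints_cases)
    have "real_of_int k = real p * of_int (k div int p) + of_int (k mod int p)"
      by (metis mult_div_mod_eq of_int_add of_int_mult of_int_of_nat_eq)
    then have "real p * (r - of_int (k mod int p) / real p) = real p * of_int (k div int p)"
      using k assms by (simp add: right_diff_distrib)
    then have "r - of_int (k mod int p) / real p = of_int (k div int p)"
      using assms by simp
    then have "c = abs_circle (of_int (k mod int p) / real p)"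
      unfolding r circle.abs_eq_iff by (metis Ints_of_int)
    then show "c \<in> (\<lambda>m. abs_circle (of_int m / real p)) ` {0..<int p}"
      using assms by auto
  qed
qed simp

lemma additive_sum_const_eq_0:
  fixes h :: "'p::prime_card Fp_omega \<Rightarrow> 'c::ab_group_add"
  assumes "additive h" "finite F" "CARD('p) dvd card F"
  shows "(\<Sum>i\<in>F. h x) = 0"
proof -
  have "(\<Sum>i\<in>F. h x) = h (of_nat (card F) * x)"
    unfolding additive.sum[OF assms(1), symmetric] by simp
  then show ?thesis
    using of_nat_Fp_omega_eq_0[OF assms(3)] by (simp add: additive.zero[OF assms(1)])
qed

lemma countable_Fp_omega: "countable (UNIV :: 'p::prime_card Fp_omega set)"
proof -
  have "x \<in> (\<Union>n. level n)" for x :: "'p Fp_omega"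
    using finite_nat_iff_bounded[of "Poly_Mapping.keys x"] by (auto simp: level_def)
  then have eq: "UNIV = (\<Union>n. level n :: 'p Fp_omega set)" by blast
  have "countable (\<Union>n. level n :: 'p Fp_omega set)"
    by (rule countable_UN) (simp_all add: countable_finite finite_level)
  then show ?thesis by (simp only: eq)
qed

lemma infinitely_repeating_enumeration:
  assumes "countable (UNIV :: 'a set)"
  obtains g :: "nat \<Rightarrow> 'a" where "\<And>x. infinite {n. g n = x}"
proof
  \<comment> \<open>The second component of the decoded pair is a dummy that repeats each value
    infinitely often.\<close>
  define g where "g n = from_nat_into (UNIV :: 'a set) (fst (prod_decode n))" for n
  fix x
  obtain m where "from_nat_into (UNIV :: 'a set) m = x"
    using from_nat_into_surj[OF assms] by blast
  then have "range (\<lambda>k. prod_encode (m, k)) \<subseteq> {n. g n = x}"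
    by (auto simp: g_def)
  moreover have "infinite (range (\<lambda>k. prod_encode (m, k)))"
    by (rule range_inj_infinite) (auto simp: inj_on_def)
  ultimately show "infinite {n. g n = x}"
    using finite_subset by blast
qed

lemma Bohr_recurrence_lift:
  fixes S :: "'p::prime_card Fp_omega set" and \<phi> :: "'p Fp_omega \<Rightarrow> 'p Fp_omega"
  assumes S: "Bohr_recurrence S" and d: "d > 2" "CARD('p) dvd d"
    and \<phi>: "additive \<phi>" and rep: "\<And>x. infinite {n. \<phi> (Poly_Mapping.single n 1) = x}"
  shows "Bohr_recurrence {b \<in> basis_sums d. \<phi> b \<in> S}"
  unfolding Bohr_recurrence_def
proof (intro allI impI)
  fix k :: nat and \<rho> :: "'p Fp_omega \<Rightarrow> nat \<Rightarrow> circle" and \<epsilon> :: real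
  assume k: "1 \<le> k" and \<rho>: "torus_hom k \<rho>" and \<epsilon>: "0 < \<epsilon>"
  let ?e = "\<lambda>n. Poly_Mapping.single n 1 :: 'p Fp_omega"
  have add: "additive (\<lambda>g. \<rho> g j)" if "j \<in> {1..k}" for j
    using \<rho> that by (simp add: torus_hom_def)
  \<comment> \<open>Coordinates outside \<open>{1..k}\<close> are unconstrained by
    \<open>torus_hom\<close>, so they are set to 0 to keep the range finite.\<close>
  define c where "c n = (\<lambda>j. if j \<in> {1..k} then \<rho> (?e n) j else 0)" for n
  let ?T = "{c :: circle. (\<Sum>i<CARD('p). c) = 0}"
  have "range c \<subseteq> {f. \<forall>j. (j \<in> {1..k} \<longrightarrow> f j \<in> ?T) \<and> (j \<notin> {1..k} \<longrightarrow> f j = 0)}"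
    using additive_sum_const_eq_0[OF add, of _ "{..<CARD('p)}"] by (auto simp: c_def)
  then have fin: "finite (range c)"
    by (rule finite_subset) (intro finite_set_of_finite_funs finite_circle_torsion; simp)
  have "\<exists>a\<in>range c. infinite {n. \<phi> (?e n) = x \<and> c n = a}" for x
  proof -
    have "finite (c ` {n. \<phi> (?e n) = x})"
      using fin by (rule finite_subset[rotated]) auto
    from pigeonhole_infinite[OF rep this] obtain n where
      "infinite {m \<in> {n. \<phi> (?e n) = x}. c m = c n}" by blast
    then show ?thesis
      by (intro bexI[of _ "c n"]) simp_all
  qed
  then obtain \<kappa> where \<kappa>: "\<And>x. \<kappa> x \<in> range c" "\<And>x. infinite {n. \<phi> (?e n) = x \<and> c n = \<kappa> x}"
    by metis
  have "range \<kappa> \<subseteq> range c" using \<kappa>(1) by blast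
  from monochromatic_sums[OF fin this d] obtain M where M: "M \<ge> (1::nat)"
    "\<And>n. \<exists>U a. \<forall>s\<in>level n. (\<forall>j\<in>{1..M}. dot (U j) s = 0) \<longrightarrow>
      (\<exists>xs. length xs = d \<and> sum_list xs = s \<and> (\<forall>x\<in>set xs. \<kappa> x = a))" by blast
  \<comment> \<open>The order matters: \<open>M\<close> depends on the colouring alone,
    \<open>n\<close> on \<open>M\<close>, and only then are the functionals \<open>U\<close> chosen
    for this level.\<close>
  from Bohr_recurrence_finitary[OF S M(1)] obtain n where
    n: "\<And>U :: nat \<Rightarrow> nat \<Rightarrow> 'p mod_ring. \<exists>s\<in>S. s \<in> level n \<and> (\<forall>j\<in>{1..M}. dot (U j) s = 0)"
    by blast
  from M(2)[of n] obtain U a where "\<forall>s\<in>level n. (\<forall>j\<in>{1..M}. dot (U j) s = 0) \<longrightarrow>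
      (\<exists>xs. length xs = d \<and> sum_list xs = s \<and> (\<forall>x\<in>set xs. \<kappa> x = a))" by blast
  with n[of U] obtain s xs where s: "s \<in> S" and xs: "length xs = d" "sum_list xs = s"
    "\<forall>x\<in>set xs. \<kappa> x = a" by blast
  have "infinite {n. \<phi> (?e n) = x \<and> c n = a}" if "x \<in> set xs" for x
    using \<kappa>(2)[of x] xs(3) that by auto
  from distinct_preimages[of xs "\<lambda>n. \<phi> (?e n)" c a, OF this] obtain F where
    F: "finite F" "card F = d" "(\<Sum>n\<in>F. \<phi> (?e n)) = s" "\<forall>n\<in>F. c n = a"
    using xs by blast
  \<comment> \<open>All d basis vectors share one torus value, which p annihilates; so the norm is
    exactly 0, whatever \<epsilon> is.\<close>
  have "\<rho> (basis_sum F) j = 0" if j: "j \<in> {1..k}" for j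
  proof -
    from F(2) d(1) obtain n0 where n0: "n0 \<in> F" by fastforce
    have "\<rho> (?e n) j = \<rho> (?e n0) j" if "n \<in> F" for n
    proof -
      have "c n j = c n0 j" using F(4) that n0 by simp
      then show ?thesis using j by (simp add: c_def)
    qed
    then have "\<rho> (basis_sum F) j = (\<Sum>n\<in>F. \<rho> (?e n0) j)"
      by (simp add: basis_sum_conv[OF add[OF j]])
    also have "\<dots> = 0"
      using additive_sum_const_eq_0[OF add[OF j] F(1)] F(2) d(2) by blast
    finally show ?thesis .
  qed
  then have "(\<lambda>j. circle_norm (\<rho> (basis_sum F) j)) ` {1..k} = {circle_norm 0}"
    using k by (auto simp: image_iff)
  moreover have "circle_norm 0 = 0"
    using circle_norm_attained(1)[of 0] by (simp add: zero_circle.abs_eq)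
  ultimately have "torus_norm k (\<rho> (basis_sum F)) < \<epsilon>"
    using \<epsilon> by (simp add: torus_norm_def)
  moreover have "basis_sum F \<in> {b \<in> basis_sums d. \<phi> b \<in> S}"
    using F s by (auto simp: basis_sums_def basis_sum_conv[OF \<phi>])
  ultimately show "\<exists>s\<in>{b \<in> basis_sums d. \<phi> b \<in> S}. torus_norm k (\<rho> s) < \<epsilon>"
    by blast
qed

text \<open>A colouring of the target pulls back along \<open>\<phi>\<close>, and a monochromatic
  pair maps forward.\<close>

lemma chromatic_recurrence_image:
  assumes \<phi>: "additive \<phi>" and T: "chromatic_recurrence T" "\<phi> ` T \<subseteq> S"
  shows "chromatic_recurrence S"
  unfolding chromatic_recurrence_def
proof (intro allI impI)
  fix r :: nat and f :: "'b \<Rightarrow> nat" assume "range f \<subseteq> {1..r}"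
  then have "range (f \<circ> \<phi>) \<subseteq> {1..r}" by auto
  then obtain a b where ab: "(f \<circ> \<phi>) a = (f \<circ> \<phi>) b" "b - a \<in> T"
    using T(1) unfolding chromatic_recurrence_def by blast
  have "\<phi> b - \<phi> a \<in> S"
    using ab(2) T(2) unfolding additive.diff[OF \<phi>, symmetric] by blast
  with ab(1) show "\<exists>a b. f a = f b \<and> b - a \<in> S"
    unfolding comp_apply by blast
qed

theorem proposition4p4:
  fixes p d :: nat
  assumes "p = CARD('p::prime_card)"
    and "d > 2" and "p dvd d"
    and "\<And>S :: 'p Fp_omega set.
           S \<subseteq> basis_sums d \<Longrightarrow> Bohr_recurrence S \<Longrightarrow> chromatic_recurrence S"
  shows "\<forall>S :: 'p Fp_omega set. Bohr_recurrence S \<longrightarrow> chromatic_recurrence S"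
proof (intro allI impI)
  fix S :: "'p Fp_omega set"
  assume S: "Bohr_recurrence S"
  obtain g :: "nat \<Rightarrow> 'p Fp_omega" where g: "\<And>x. infinite {n. g n = x}"
    by (rule infinitely_repeating_enumeration[OF countable_Fp_omega], rule that)
  \<comment> \<open>The linear map sending the n-th basis vector to \<open>g n\<close>; convolution
    with \<open>single 0 c\<close> is multiplication by the scalar \<open>c\<close>.\<close>
  define \<phi> :: "'p Fp_omega \<Rightarrow> 'p Fp_omega"
    where "\<phi> x = (\<Sum>i\<in>Poly_Mapping.keys x. Poly_Mapping.single 0 (Poly_Mapping.lookup x i) * g i)" for x
  have add: "additive \<phi>"
    unfolding \<phi>_def[abs_def]
    by (rule additive_sum_keys) (simp add: additive_def single_add distrib_right)
  have "\<phi> (Poly_Mapping.single n 1) = g n" for n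
    by (simp add: \<phi>_def)
  then have "Bohr_recurrence {b \<in> basis_sums d. \<phi> b \<in> S}"
    using S assms(1-3) g by (intro Bohr_recurrence_lift add) auto
  then have "chromatic_recurrence {b \<in> basis_sums d. \<phi> b \<in> S}"
    by (intro assms(4)) auto
  then show "chromatic_recurrence S"
    by (rule chromatic_recurrence_image[OF add]) auto
qed

end
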